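(* Let $\mathbb{T}$ be a time scale, $t_0\in\mathbb{T}$, and let $\alpha:\mathbb{T}\to\mathbb{C}$ be a regressive rd-continuous function. Then $x(t)=E_\alpha(t,t_0)$ is the unique solution $x:\mathbb{T}\to\mathbb{C}$ of the Cauchy problem $$x^\Delta(t)=\alpha(t)\,\langle x(t)\rangle\quad(t\in\mathbb{T}^\kappa),\qquad x(t_0)=1,$$ where $\langle x(t)\rangle:=\frac{x(t)+x(\sigma(t))}{2}$.
   Context: A time scale $\mathbb{T}$ is a nonempty closed subset of $\mathbb{R}$. Forward jump: $\sigma(t)=\inf\{s\in\mathbb{T}:s>t\}$ (with $\inf\emptyset=\sup\mathbb{T}$). A point $t$ is right-dense if $\sigma(t)=t$, right-scattered if $\sigma(t)>t$; left-dense/left-scattered are defined analogously with the backward jump operator. $\mathbb{T}^\kappa$ is $\mathbb{T}$ minus its left-scattered maximum if that exists, and $\mathbb{T}^\kappa=\mathbb{T}$ otherwise. Graininess: $\mu(t)=\sigma(t)-t$. A function is rd-continuous if it is continuous at right-dense points and has finite left-hand limits at left-dense points. The delta derivative at $t\in\mathbb{T}^\kappa$ is $f^\Delta(t)=\lim_{s\to t,\,s\neq\sigma(t)}\frac{f(\sigma(t))-f(s)}{\sigma(t)-s}$ ($s\in\mathbb{T}$, $s=t$ allowed when $t\ne\sigma(t)$). The delta integral is $\int_{t_0}^t f(s)\,\Delta s=F(t)-F(t_0)$ where $F^\Delta=f$ on $\mathbb{T}^\kappa$; it exists for rd-continuous $f$. A function $\alpha:\mathbb{T}\to\mathbb{C}$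 is regressive if $\mu(t)\alpha(t)\neq\pm2$ for all $t\in\mathbb{T}^\kappa$. With $\log$ the principal branch of the complex logarithm, $\zeta_h(z)=\frac1h\log\frac{1+\frac12zh}{1-\frac12zh}$ for $h>0$ and $\zeta_0(z)=z$. The Cayley-exponential function is $E_\alpha(t,t_0)=\exp\left(\int_{t_0}^t\zeta_{\mu(s)}(\alpha(s))\,\Delta s\right)$ for rd-continuous regressive $\alpha$. *)

theory Defs
  imports "HOL-Analysis.Analysis"
begin

text \<open>
  A function on a time scale \<open>T\<close> is represented by a total function on the reals; every notion
  below, applied at points of \<open>T\<close>, depends only on the values of that function on \<open>T\<close>.
\<close>

definition time_scale :: "real set \<Rightarrow> bool" where
  "time_scale T \<longleftrightarrow> closed T \<and> T \<noteq> {}"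

definition fjump :: "real set \<Rightarrow> real \<Rightarrow> real" where
  "fjump T t = (if {s \<in> T. t < s} = {} then Sup T else Inf {s \<in> T. t < s})"

definition bjump :: "real set \<Rightarrow> real \<Rightarrow> real" where
  "bjump T t = (if {s \<in> T. s < t} = {} then Inf T else Sup {s \<in> T. s < t})"

definition graininess :: "real set \<Rightarrow> real \<Rightarrow> real" where
  "graininess T t = fjump T t - t"

text \<open>By the conventions for the empty set, a maximum of \<open>T\<close> is right-dense and a minimum is
  left-dense.\<close>

definition right_dense :: "real set \<Rightarrow> real \<Rightarrow> bool" where
  "right_dense T t \<longleftrightarrow> fjump T t = t"

definition left_dense :: "real set \<Rightarrow> real \<Rightarrow> bool" where
  "left_dense T t \<longleftrightarrow> bjump T t = t"

definition left_scattered :: "real set \<Rightarrow> real \<Rightarrow> bool" where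
  "left_scattered T t \<longleftrightarrow> bjump T t < t"

definition kappa_part :: "real set \<Rightarrow> real set" where
  "kappa_part T = T - {t \<in> T. (\<forall>s\<in>T. s \<le> t) \<and> left_scattered T t}"

definition rd_continuous :: "real set \<Rightarrow> (real \<Rightarrow> complex) \<Rightarrow> bool" where
  "rd_continuous T f \<longleftrightarrow>
     (\<forall>t\<in>T. right_dense T t \<longrightarrow> continuous (at t within T) f) \<and>
     (\<forall>t\<in>T. left_dense T t \<longrightarrow> (\<exists>l. (f \<longlongrightarrow> l) (at t within (T \<inter> {..<t}))))"

text \<open>The filter lets \<open>s\<close> tend to \<open>t\<close> inside \<open>T\<close> with \<open>s \<noteq> fjump T t\<close>; unlike \<^term>\<open>at t within T\<close>,
  it admits \<open>s = t\<close> when \<open>t\<close> is right-scattered. For \<open>t\<close> in \<^term>\<open>kappa_part T\<close> it is trivial only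
  if \<open>T\<close> is a single point.\<close>

definition has_delta_derivative ::
    "real set \<Rightarrow> (real \<Rightarrow> complex) \<Rightarrow> complex \<Rightarrow> real \<Rightarrow> bool" where
  "has_delta_derivative T f D t \<longleftrightarrow>
     ((\<lambda>s. (f (fjump T t) - f s) / complex_of_real (fjump T t - s)) \<longlongrightarrow> D)
       (inf (nhds t) (principal (T - {fjump T t})))"

definition delta_antiderivative ::
    "real set \<Rightarrow> (real \<Rightarrow> complex) \<Rightarrow> (real \<Rightarrow> complex) \<Rightarrow> bool" where
  "delta_antiderivative T f F \<longleftrightarrow> (\<forall>t\<in>kappa_part T. has_delta_derivative T F (f t) t)"

text \<open>Antiderivatives on \<open>T\<close> differ by a constant, so for \<open>a\<close> and \<open>b\<close> in \<open>T\<close> the choice is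
  immaterial.\<close>

definition delta_integral ::
    "real set \<Rightarrow> real \<Rightarrow> real \<Rightarrow> (real \<Rightarrow> complex) \<Rightarrow> complex" where
  "delta_integral T a b f = (let F = (SOME F. delta_antiderivative T f F) in F b - F a)"

definition regressive :: "real set \<Rightarrow> (real \<Rightarrow> complex) \<Rightarrow> bool" where
  "regressive T \<alpha> \<longleftrightarrow>
     (\<forall>t\<in>kappa_part T. complex_of_real (graininess T t) * \<alpha> t \<noteq> 2 \<and>
                      complex_of_real (graininess T t) * \<alpha> t \<noteq> -2)"

definition cayley_zeta :: "real \<Rightarrow> complex \<Rightarrow> complex" where
  "cayley_zeta h z =
     (if h = 0 then z
      else 1 / complex_of_real h *
           Ln ((1 + 1/2 * z * complex_of_real h) / (1 - 1/2 * z * complex_of_real h)))"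

definition cayley_exp :: "real set \<Rightarrow> (real \<Rightarrow> complex) \<Rightarrow> real \<Rightarrow> real \<Rightarrow> complex" where
  "cayley_exp T \<alpha> t t0 =
     exp (delta_integral T t0 t (\<lambda>s. cayley_zeta (graininess T s) (\<alpha> s)))"

definition jump_average :: "real set \<Rightarrow> (real \<Rightarrow> complex) \<Rightarrow> real \<Rightarrow> complex" where
  "jump_average T x t = (x t + x (fjump T t)) / 2"

definition cayley_cauchy_solution ::
    "real set \<Rightarrow> (real \<Rightarrow> complex) \<Rightarrow> real \<Rightarrow> (real \<Rightarrow> complex) \<Rightarrow> bool" where
  "cayley_cauchy_solution T \<alpha> t0 x \<longleftrightarrow>
     (\<forall>t\<in>kappa_part T. has_delta_derivative T x (\<alpha> t * jump_average T x t) t) \<and> x t0 = 1"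

end

theory Submission
  imports Defs
begin

text \<open>
  At a right-dense point the delta derivative is the ordinary derivative within \<open>T\<close>, and at a
  right-scattered point it is continuity together with a difference equation for the jump. Hence
  an antiderivative of an rd-continuous \<open>f\<close> is obtained by integrating the step extension
  of \<open>f\<close> that is constant across the gaps of \<open>T\<close>: this extension has one-sided limits
  everywhere. On a gap, \<open>exp (\<mu> \<zeta>\<^sub>\<mu> \<alpha>)\<close> is the ratio \<open>(2 + \<mu> \<alpha>) / (2 - \<mu> \<alpha>)\<close> which the
  Cauchy problem prescribes for the jump of any solution, and as \<open>\<mu> \<rightarrow> 0\<close> the function
  \<open>\<zeta>\<^sub>\<mu> \<alpha>\<close> tends to \<open>\<alpha>\<close>, so the Cayley exponential is a solution. The quotient of any solution
  by it has delta derivative zero, hence is constant.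
\<close>

section \<open>Integrability of regulated functions\<close>

text \<open>One-sided limits keep \<open>f\<close> within \<open>e\<close> of a constant on either
  side of each point, and a fine tagged division selects finitely many such neighbourhoods. So
  \<open>f\<close> is a uniform limit of integrable functions.\<close>

lemma integrable_on_regulated:
  fixes f :: "real \<Rightarrow> 'a::banach"
  assumes left: "\<And>x. \<lbrakk>a < x; x \<le> b\<rbrakk> \<Longrightarrow> \<exists>l. (f \<longlongrightarrow> l) (at_left x)"
    and right: "\<And>x. \<lbrakk>a \<le> x; x < b\<rbrakk> \<Longrightarrow> \<exists>r. (f \<longlongrightarrow> r) (at_right x)"
  shows "f integrable_on {a..b}"
proof -
  have "f integrable_on cbox a b"
  proof (rule integrable_uniform_limit)
    fix e :: real
    assume e: "e > 0"
    have "\<exists>d>0. \<exists>l r. \<forall>u\<in>{a..b}. (x - d < u \<longrightarrow> u < x \<longrightarrow> norm (f u - l) \<le> e) \<and>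
            (x < u \<longrightarrow> u < x + d \<longrightarrow> norm (f u - r) \<le> e)" if x: "x \<in> {a..b}" for x
    proof -
      have "\<exists>d>0. \<exists>l. \<forall>u\<in>{a..b}. x - d < u \<longrightarrow> u < x \<longrightarrow> norm (f u - l) \<le> e"
      proof (cases "a < x")
        case True
        then obtain l where "(f \<longlongrightarrow> l) (at_left x)" using left x by auto
        then have "eventually (\<lambda>u. dist (f u) l < e) (at_left x)" using e by (rule tendstoD)
        then obtain y where "y < x" "\<And>u. y < u \<Longrightarrow> u < x \<Longrightarrow> dist (f u) l < e"
          unfolding eventually_at_left[OF True] by auto
        then show ?thesis
          by (intro exI[of _ "x - y"] conjI exI[of _ l]) (auto simp: dist_norm less_imp_le)
      next
        case False
        then show ?thesis using x by (intro exI[of _ 1]) auto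
      qed
      then obtain d l where d: "d > 0"
        "\<And>u. u \<in> {a..b} \<Longrightarrow> x - d < u \<Longrightarrow> u < x \<Longrightarrow> norm (f u - l) \<le> e" by metis
      have "\<exists>d>0. \<exists>r. \<forall>u\<in>{a..b}. x < u \<longrightarrow> u < x + d \<longrightarrow> norm (f u - r) \<le> e"
      proof (cases "x < b")
        case True
        then obtain r where "(f \<longlongrightarrow> r) (at_right x)" using right x by auto
        then have "eventually (\<lambda>u. dist (f u) r < e) (at_right x)" using e by (rule tendstoD)
        then obtain y where "y > x" "\<And>u. x < u \<Longrightarrow> u < y \<Longrightarrow> dist (f u) r < e"
          unfolding eventually_at_right[OF True] by auto
        then show ?thesis
          by (intro exI[of _ "y - x"] conjI exI[of _ r]) (auto simp: dist_norm less_imp_le)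
      next
        case False
        then show ?thesis using x by (intro exI[of _ 1]) auto
      qed
      then obtain d' r where d': "d' > 0"
        "\<And>u. u \<in> {a..b} \<Longrightarrow> x < u \<Longrightarrow> u < x + d' \<Longrightarrow> norm (f u - r) \<le> e" by metis
      show ?thesis
        using d d' by (intro exI[of _ "min d d'"] conjI exI[of _ l] exI[of _ r]) auto
    qed
    then obtain d l r where d: "\<And>x. x \<in> {a..b} \<Longrightarrow> d x > 0"
      and dl: "\<And>x u. \<lbrakk>x \<in> {a..b}; u \<in> {a..b}; x - d x < u; u < x\<rbrakk> \<Longrightarrow> norm (f u - l x) \<le> e"
      and dr: "\<And>x u. \<lbrakk>x \<in> {a..b}; u \<in> {a..b}; x < u; u < x + d x\<rbrakk> \<Longrightarrow> norm (f u - r x) \<le> e"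
      by metis
    define \<gamma> where "\<gamma> = (\<lambda>x. ball x (if x \<in> {a..b} then d x else 1))"
    have "gauge \<gamma>"
      unfolding \<gamma>_def gauge_def using d by auto
    then obtain p where ptag: "p tagged_division_of cbox a b" and finep: "\<gamma> fine p"
      using fine_division_exists by blast
    have *: "\<forall>i\<in>snd ` p. \<exists>g. (\<forall>x\<in>i. norm (f x - g x) \<le> e) \<and> g integrable_on i"
    proof clarsimp
      fix x i
      assume xi: "(x, i) \<in> p"
      obtain c c' where i: "i = cbox c c'" using xi ptag by blast
      have ix: "x \<in> i" and iab: "i \<subseteq> {a..b}"
        using tagged_division_ofD(2,3)[OF ptag xi] by auto
      then have x: "x \<in> {a..b}" by blast
      have ib: "i \<subseteq> ball x (d x)" using xi finep x unfolding \<gamma>_def fine_def by force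
      \<comment> \<open>The value at the tag is copied from \<open>f\<close>, since the one-sided
        limits say nothing about it; one point does not affect integrability.\<close>
      define g where "g = (\<lambda>u. if u = x then f x else if u \<le> x then l x else r x)"
      have 1: "norm (f u - g u) \<le> e" if "u \<in> i" for u
      proof -
        have u: "u \<in> {a..b}" "x - d x < u" "u < x + d x"
          using that iab ib by (auto simp: dist_real_def subset_iff)
        show ?thesis
          using dl[OF x u(1,2)] dr[OF x u(1) _ u(3)] e by (auto simp: g_def)
      qed
      have "g integrable_on {c..x}"
      proof (rule integrable_spike_finite[of "{x}"])
        show "(\<lambda>_. l x) integrable_on {c..x}" by (rule integrable_const_ivl)
      qed (auto simp: g_def)
      moreover have "g integrable_on {x..c'}"
      proof (rule integrable_spike_finite[of "{x}"])
        show "(\<lambda>_. r x) integrable_on {x..c'}" by (rule integrable_const_ivl)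
      qed (auto simp: g_def)
      ultimately have "g integrable_on i"
        using ix i Henstock_Kurzweil_Integration.integrable_combine[of c x c' g] by auto
      with 1 show "\<exists>g. (\<forall>x\<in>i. norm (f x - g x) \<le> e) \<and> g integrable_on i" by blast
    qed
    from approximable_on_division[OF less_imp_le[OF e] division_of_tagged_division[OF ptag] *]
    show "\<exists>g. (\<forall>x\<in>cbox a b. norm (f x - g x) \<le> e) \<and> g integrable_on cbox a b"
      by metis
  qed
  then show ?thesis by simp
qed

section \<open>The forward jump and the delta derivative\<close>

lemma fjump_ge:
  assumes "t \<in> T"
  shows "t \<le> fjump T t"
proof (cases "{s \<in> T. t < s} = {}")
  case True
  then have "Sup T = t" using assms by (intro cSup_eq_maximum) (auto simp: not_less)
  then show ?thesis by (simp add: fjump_def True)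
next
  case False
  then show ?thesis by (auto simp: fjump_def intro!: cInf_greatest)
qed

lemma fjump_le:
  assumes "s \<in> T" "t < s"
  shows "fjump T t \<le> s"
proof -
  have "{s \<in> T. t < s} \<noteq> {}" using assms by blast
  then show ?thesis
    using assms by (auto simp: fjump_def intro!: cInf_lower bdd_belowI[of _ t])
qed

lemma fjump_in:
  assumes "closed T" "t \<in> T"
  shows "fjump T t \<in> T"
proof (cases "{s \<in> T. t < s} = {}")
  case True
  then have "Sup T = t" using assms by (intro cSup_eq_maximum) (auto simp: not_less)
  then show ?thesis using assms by (simp add: fjump_def True)
next
  case False
  have "Inf {s \<in> T. t < s} \<in> closure {s \<in> T. t < s}"
    using False by (intro closure_contains_Inf bdd_belowI[of _ t]) auto
  also have "\<dots> \<subseteq> T" using assms by (intro closure_minimal) auto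
  finally show ?thesis using False by (simp only: fjump_def if_False)
qed

text \<open>The point \<open>s\<close> rules out the maximum of \<open>T\<close>, which is
  right-dense by convention although no point of \<open>T\<close> follows it.\<close>

lemma right_denseD:
  assumes "fjump T t = t" "s \<in> T" "t < s" "e > 0"
  obtains r where "r \<in> T" "t < r" "r < t + e"
proof -
  have ne: "{s \<in> T. t < s} \<noteq> {}" using assms by blast
  then have "Inf {s \<in> T. t < s} < t + e" using assms by (simp only: fjump_def if_False)
  then show thesis using cInf_lessD[OF ne] that by blast
qed

text \<open>Here the filter of the delta derivative is exactly \<open>at t within T\<close>, and the
  normalised remainder of the vector derivative has the norm of the difference quotient minus
  \<open>D\<close>.\<close>

lemma has_delta_derivative_right_dense:
  assumes "fjump T t = t"
  shows "has_delta_derivative T f D t \<longleftrightarrow> (f has_vector_derivative D) (at t within T)"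
proof -
  have "norm ((1 / norm (s - t)) *\<^sub>R (f s - (f t + (s - t) *\<^sub>R D))) =
      norm ((f t - f s) / complex_of_real (t - s) - D)" if "s \<noteq> t" for s
  proof -
    have "(f t - f s) / complex_of_real (t - s) - D = (f s - (f t + (s - t) *\<^sub>R D)) / of_real (s - t)"
      using that by (simp add: scaleR_conv_of_real divide_simps) (auto simp: algebra_simps)
    then show ?thesis by (simp add: norm_divide flip: of_real_diff)
  qed
  then have eq: "\<forall>\<^sub>F s in at t within T. norm ((1 / norm (s - t)) *\<^sub>R (f s - (f t + (s - t) *\<^sub>R D))) =
      norm ((f t - f s) / complex_of_real (t - s) - D)"
    by (simp add: eventually_at_filter)
  have "(f has_vector_derivative D) (at t within T) \<longleftrightarrow>
      ((\<lambda>s. norm ((1 / norm (s - t)) *\<^sub>R (f s - (f t + (s - t) *\<^sub>R D)))) \<longlongrightarrow> 0) (at t within T)"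
    unfolding has_vector_derivative_def has_derivative_within tendsto_norm_zero_iff
    by (simp add: bounded_linear_scaleR_left)
  also have "\<dots> \<longleftrightarrow> ((\<lambda>s. norm ((f t - f s) / complex_of_real (t - s) - D)) \<longlongrightarrow> 0) (at t within T)"
    by (rule tendsto_cong[OF eq])
  also have "\<dots> \<longleftrightarrow> has_delta_derivative T f D t"
    unfolding has_delta_derivative_def assms at_within_def tendsto_norm_zero_iff
    by (simp add: Lim_null[symmetric])
  finally show ?thesis ..
qed

text \<open>Near \<open>t\<close> the condition \<open>s \<noteq> fjump T t\<close> is automatic and
  the filter contains \<open>t\<close> itself. The value of the quotient at \<open>t\<close> gives
  the jump equation, and its denominator stays away from zero, so its convergence amounts to
  continuity of \<open>f\<close>.\<close>

lemma has_delta_derivative_right_scattered: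
  assumes "t \<in> T" "t < fjump T t"
  shows "has_delta_derivative T f D t \<longleftrightarrow> continuous (at t within T) f \<and>
    f (fjump T t) - f t = of_real (graininess T t) * D"
proof -
  let ?\<sigma> = "fjump T t" and ?F = "inf (nhds t) (principal (T - {fjump T t}))"
  have ev: "\<forall>\<^sub>F s in nhds t. s \<noteq> ?\<sigma>" using assms by (intro t1_space_nhds) auto
  have F: "?F = inf (nhds t) (principal T)"
    unfolding filter_eq_iff eventually_inf_principal
    using ev by (auto elim: eventually_elim2)
  have cont: "continuous (at t within T) f \<longleftrightarrow> (f \<longlongrightarrow> f t) ?F"
    unfolding continuous_within tendsto_at_within_iff_tendsto_nhds F ..
  have id: "((\<lambda>s. s) \<longlongrightarrow> t) ?F" by (auto intro: tendsto_mono[OF inf_le1] filterlim_ident)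
  have ne: "\<forall>\<^sub>F s in ?F. s \<noteq> ?\<sigma>" using ev by (simp add: eventually_inf_principal)
  have \<sigma>: "complex_of_real (?\<sigma> - t) \<noteq> 0" using assms by (simp del: of_real_diff)
  show ?thesis
  proof
    assume L: "has_delta_derivative T f D t"
    \<comment> \<open>Every set of the filter contains \<open>t\<close>, so the limit must equal the
      quotient at \<open>s = t\<close>.\<close>
    have "principal {t} \<le> ?F"
      using assms
      by (auto simp: le_filter_def eventually_inf_principal eventually_principal
          dest: eventually_nhds_x_imp_x)
    then have "((\<lambda>s. (f ?\<sigma> - f s) / complex_of_real (?\<sigma> - s)) \<longlongrightarrow> D) (principal {t})"
      using L unfolding has_delta_derivative_def by (rule tendsto_mono)
    then have "((\<lambda>s. (f ?\<sigma> - f t) / complex_of_real (?\<sigma> - t)) \<longlongrightarrow> D) (principal {t})"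
      by (rule Lim_transform_eventually) (simp add: eventually_principal)
    then have "(f ?\<sigma> - f t) / complex_of_real (?\<sigma> - t) = D"
      by (subst (asm) tendsto_const_iff) (auto simp: principal_eq_bot_iff)
    then have D: "f ?\<sigma> - f t = of_real (?\<sigma> - t) * D" using \<sigma> by (auto simp: field_simps)
    \<comment> \<open>Solving the quotient for \<open>f s\<close> turns its limit into a limit of
      \<open>f\<close>.\<close>
    have "((\<lambda>s. f ?\<sigma> - (f ?\<sigma> - f s) / complex_of_real (?\<sigma> - s) * of_real (?\<sigma> - s)) \<longlongrightarrow>
        f ?\<sigma> - D * of_real (?\<sigma> - t)) ?F"
      using L unfolding has_delta_derivative_def by (intro tendsto_intros id)
    then have "(f \<longlongrightarrow> f ?\<sigma> - D * of_real (?\<sigma> - t)) ?F"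
      by (rule Lim_transform_eventually) (use ne in eventually_elim, simp)
    moreover have "f ?\<sigma> - D * of_real (?\<sigma> - t) = f t" using D by (simp add: algebra_simps)
    ultimately show "continuous (at t within T) f \<and> f ?\<sigma> - f t = of_real (graininess T t) * D"
      using D by (simp add: cont graininess_def)
  next
    assume R: "continuous (at t within T) f \<and> f ?\<sigma> - f t = of_real (graininess T t) * D"
    then have "(f \<longlongrightarrow> f t) ?F" by (simp add: cont)
    then have "((\<lambda>s. (f ?\<sigma> - f s) / complex_of_real (?\<sigma> - s)) \<longlongrightarrow>
        (f ?\<sigma> - f t) / complex_of_real (?\<sigma> - t)) ?F"
      by (intro tendsto_intros id \<sigma>)
    moreover have "(f ?\<sigma> - f t) / complex_of_real (?\<sigma> - t) = D"
      using R \<sigma> by (simp add: graininess_def)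
    ultimately show "has_delta_derivative T f D t" by (simp add: has_delta_derivative_def)
  qed
qed

lemma has_delta_derivative_continuous:
  assumes "t \<in> T" "has_delta_derivative T f D t"
  shows "continuous (at t within T) f"
  using assms fjump_ge[OF assms(1)] has_delta_derivative_right_dense[of T t f D]
    has_delta_derivative_right_scattered[of t T f D]
  by (metis has_vector_derivative_continuous order_le_less)

text \<open>A point of \<open>T\<close> outside \<^term>\<open>kappa_part T\<close> is isolated in \<open>T\<close>.\<close>

lemma kappa_part_continuous:
  assumes "\<And>t. t \<in> kappa_part T \<Longrightarrow> continuous (at t within T) f"
  shows "continuous_on T f"
  unfolding continuous_on_eq_continuous_within
proof
  fix t
  assume t: "t \<in> T"
  show "continuous (at t within T) f"
  proof (cases "t \<in> kappa_part T")
    case False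
    then have max: "\<forall>s\<in>T. s \<le> t" and ls: "bjump T t < t"
      using t by (auto simp: kappa_part_def left_scattered_def)
    have "\<not> t islimpt T"
    proof
      assume "t islimpt T"
      then obtain s where s: "s \<in> T" "s \<noteq> t" "dist s t < t - bjump T t"
        using ls unfolding islimpt_approachable by (metis diff_gt_0_iff_gt)
      then have "s < t" "bjump T t < s" using max by (auto simp: dist_real_def order_less_le)
      moreover from \<open>s < t\<close> s have "s \<le> bjump T t"
        by (auto simp: bjump_def intro!: cSup_upper bdd_aboveI[of _ t])
      ultimately show False by simp
    qed
    then have "at t within T = bot" by (simp add: trivial_limit_within)
    then show ?thesis by simp
  qed (use assms in simp)
qed

section \<open>Functions with vanishing delta derivative\<close>

text \<open>A mean value inequality proved by a supremum argument along \<open>T\<close>: for every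
  slope \<open>e > 0\<close>, the estimate \<open>norm (q r - q a) \<le> e * (r - a)\<close> can
  always be pushed beyond the last point reached, by the jump equation or by the ordinary
  derivative.\<close>

lemma delta_derivative_zero_constant:
  assumes "closed T" and a: "a \<in> T" and b: "b \<in> T"
    and q: "\<And>t. t \<in> kappa_part T \<Longrightarrow> has_delta_derivative T q 0 t"
  shows "q a = q b"
  using a b
proof (induction a b rule: linorder_wlog)
  case (le a b)
  have cont: "continuous_on T q"
    by (rule kappa_part_continuous, rule has_delta_derivative_continuous[OF _ q])
      (auto simp: kappa_part_def)
  have bound: "norm (q b - q a) \<le> e * (b - a)" if e: "e > 0" for e
  proof -
    define S where "S = {t \<in> T. a \<le> t \<and> t \<le> b \<and>
      (\<forall>r\<in>T. a \<le> r \<longrightarrow> r \<le> t \<longrightarrow> norm (q r - q a) - e * (r - a) \<le> 0)}"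
    define c where "c = Sup S"
    have aS: "a \<in> S" using le by (auto simp: S_def)
    have bdd: "bdd_above S" by (auto simp: S_def intro: bdd_aboveI[of _ b])
    have clos: "closure S \<subseteq> T \<inter> {a..b}"
      using assms(1) by (intro closure_minimal) (auto simp: S_def)
    have cc: "c \<in> closure S"
      unfolding c_def using aS bdd by (intro closure_contains_Sup) auto
    then have c: "c \<in> T" "a \<le> c" "c \<le> b" using clos by auto
    \<comment> \<open>Each point of \<open>S\<close> satisfies the estimate, and continuity of
      \<open>q\<close> carries it to the supremum.\<close>
    have "norm (q c - q a) - e * (c - a) \<le> 0"
    proof (rule continuous_le_on_closure[OF _ cc])
      show "continuous_on (closure S) (\<lambda>r. norm (q r - q a) - e * (r - a))"
        using clos by (intro continuous_intros continuous_on_subset[OF cont]) auto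
    qed (auto simp: S_def)
    moreover have "norm (q r - q a) - e * (r - a) \<le> 0" if r: "r \<in> T" "a \<le> r" "r < c" for r
    proof -
      obtain s where "s \<in> S" "r < s" using less_cSupD[of S r] r aS unfolding c_def by blast
      then show ?thesis using r by (auto simp: S_def)
    qed
    ultimately have Sc: "norm (q r - q a) - e * (r - a) \<le> 0" if "r \<in> T" "a \<le> r" "r \<le> c" for r
      using that by (cases "r = c") auto
    have max: "\<not> (t \<in> S \<and> c < t)" for t
      unfolding c_def using cSup_upper[OF _ bdd, of t] by auto
    have "c = b"
    proof (rule ccontr)
      assume "c \<noteq> b"
      then have cb: "c < b" using c by simp
      then have "c \<in> kappa_part T" using c le by (force simp: kappa_part_def)
      note d = q[OF this]
      show False
      proof (cases "fjump T c = c")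
        case False
        then have \<sigma>: "c < fjump T c" using fjump_ge[OF c(1)] by simp
        then have "q (fjump T c) = q c"
          using d has_delta_derivative_right_scattered[OF c(1) \<sigma>, of q 0] by simp
        \<comment> \<open>No point of \<open>T\<close> lies strictly between \<open>c\<close> and
          its jump, so only the jump itself has to be checked.\<close>
        moreover have "r \<le> c \<or> r = fjump T c" if "r \<in> T" "r \<le> fjump T c" for r
          using fjump_le[of r T c] that by force
        moreover have "e * (c - a) \<le> e * (fjump T c - a)"
          using e \<sigma> by simp
        ultimately have "fjump T c \<in> S"
          using Sc c fjump_in[OF assms(1) c(1)] fjump_le[of b T c] cb le \<sigma> Sc[of c]
          by (force simp: S_def)
        then show False using max \<sigma> by blast
      next
        case True
        then have "(q has_derivative (\<lambda>h. 0)) (at c within T)"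
          using d by (simp add: has_delta_derivative_right_dense has_vector_derivative_def)
        then obtain \<delta> where \<delta>: "\<delta> > 0"
          "\<And>y. y \<in> T \<Longrightarrow> \<bar>y - c\<bar> < \<delta> \<Longrightarrow> norm (q y - q c) \<le> e * \<bar>y - c\<bar>"
          using e unfolding has_derivative_within_alt by (auto simp: real_norm_def)
        \<comment> \<open>As \<open>c\<close> is right-dense and below \<open>b\<close>, some later
          point of \<open>T\<close> lies within the range \<delta> of the derivative estimate and
          before \<open>b\<close>.\<close>
        obtain r where r: "r \<in> T" "c < r" "r < c + min \<delta> (b - c)"
          using right_denseD[OF True, of b "min \<delta> (b - c)"] le cb \<delta>(1) by auto
        have "norm (q y - q a) - e * (y - a) \<le> 0" if y: "y \<in> T" "a \<le> y" "y \<le> r" for y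
        proof (cases "y \<le> c")
          case False
          then have "norm (q y - q c) \<le> e * (y - c)" using \<delta>(2)[of y] y r by auto
          moreover have "norm (q c - q a) \<le> e * (c - a)" using Sc[of c] c by simp
          moreover have "norm (q y - q a) \<le> norm (q y - q c) + norm (q c - q a)"
            using norm_triangle_ineq[of "q y - q c" "q c - q a"] by simp
          ultimately show ?thesis by (simp add: algebra_simps)
        qed (use Sc y in auto)
        then have "r \<in> S" using r c by (auto simp: S_def)
        then show False using max r by blast
      qed
    qed
    then show ?thesis using Sc[of c] c by simp
  qed
  have "norm (q b - q a) \<le> 0"
  proof (cases "a = b")
    case False
    show ?thesis
    proof (rule field_le_epsilon)
      fix e :: real assume "e > 0"
      then show "norm (q b - q a) \<le> 0 + e" using bound[of "e / (b - a)"] le False by simp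
    qed
  qed simp
  then show ?case by simp
next
  case (sym a b)
  then show ?case by simp
qed

section \<open>The step extension and existence of antiderivatives\<close>

text \<open>Below \<open>Inf T\<close> the value \<open>Inf T\<close> keeps \<open>time_floor T u\<close> in \<open>T\<close>, so that the step extension
  \<open>f \<circ> time_floor T\<close> depends only on \<open>f\<close> restricted to \<open>T\<close> and is regulated on the whole line.\<close>

definition time_floor :: "real set \<Rightarrow> real \<Rightarrow> real" where
  "time_floor T u = (if T \<inter> {..u} = {} then Inf T else Sup (T \<inter> {..u}))"

lemma time_floor_in:
  assumes "time_scale T"
  shows "time_floor T u \<in> T"
proof (cases "T \<inter> {..u} = {}")
  case True
  then have "u \<le> t" if "t \<in> T" for t using that by force
  then have "Inf T \<in> T"
    using assms unfolding time_scale_def by (intro closed_contains_Inf bdd_belowI[of _ u]) auto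
  then show ?thesis by (simp add: time_floor_def True)
next
  case False
  then have "Sup (T \<inter> {..u}) \<in> T \<inter> {..u}"
    using assms unfolding time_scale_def by (intro closed_contains_Sup bdd_aboveI[of _ u]) auto
  then show ?thesis using False by (simp only: time_floor_def if_False Int_iff)
qed

lemma time_floor_ge:
  assumes "r \<in> T" "r \<le> u"
  shows "r \<le> time_floor T u"
proof -
  have "T \<inter> {..u} \<noteq> {}" using assms by blast
  then show ?thesis
    using assms by (simp only: time_floor_def if_False) (intro cSup_upper bdd_aboveI[of _ u]; auto)
qed

lemma time_floor_le:
  assumes "r \<in> T" "r \<le> u"
  shows "time_floor T u \<le> u"
proof -
  have "T \<inter> {..u} \<noteq> {}" using assms by blast
  then show ?thesis
    by (simp only: time_floor_def if_False) (intro cSup_least; auto)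
qed

lemma time_floor_self: "t \<in> T \<Longrightarrow> time_floor T t = t"
  by (meson order_antisym order_refl time_floor_ge time_floor_le)

lemma time_floor_eq:
  assumes "u \<le> v" "T \<inter> {u<..v} = {}"
  shows "time_floor T u = time_floor T v"
proof -
  have "T \<inter> {..u} = T \<inter> {..v}" using assms by force
  then show ?thesis by (simp add: time_floor_def)
qed

text \<open>Either the floor is constant just to the left of \<open>x\<close>, or \<open>x\<close>
  is a left-dense point of \<open>T\<close> and the floor tends to \<open>x\<close> through points
  of \<open>T\<close> below it, where rd-continuity supplies the limit.\<close>

lemma time_floor_left_limit:
  assumes T: "time_scale T" and f: "rd_continuous T f"
  shows "\<exists>l. ((\<lambda>u. f (time_floor T u)) \<longlongrightarrow> l) (at_left x)"
proof (cases "\<exists>y<x. T \<inter> {y<..<x} = {}")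
  case True
  then obtain y where y: "y < x" "T \<inter> {y<..<x} = {}" by blast
  have "f (time_floor T u) = f (time_floor T y)" if "y < u" "u < x" for u
    using time_floor_eq[of y u T] that y(2) by force
  then show ?thesis
    by (intro exI[of _ "f (time_floor T y)"] tendsto_eventually)
      (use y in \<open>auto simp: eventually_at_left\<close>)
next
  case False
  then have dense: "\<exists>r\<in>T. y < r \<and> r < x" if "y < x" for y using that by force
  have "x \<in> closure T"
    unfolding closure_approachable
  proof (intro allI impI)
    fix e :: real assume "e > 0"
    then obtain r where "r \<in> T" "x - e < r" "r < x" using dense[of "x - e"] by auto
    then show "\<exists>y\<in>T. dist y x < e" by (intro bexI[of _ r]) (auto simp: dist_real_def)
  qed
  then have xT: "x \<in> T" using T by (simp add: time_scale_def)
  have ne: "{s \<in> T. s < x} \<noteq> {}" using dense[of "x - 1"] by auto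
  have "Sup {s \<in> T. s < x} = x"
    using ne dense by (intro cSup_eq_non_empty) (auto simp: not_less[symmetric])
  then have "left_dense T x" using ne by (simp only: left_dense_def bjump_def if_False)
  then obtain l where l: "(f \<longlongrightarrow> l) (at x within (T \<inter> {..<x}))"
    using f xT by (auto simp: rd_continuous_def)
  have lim: "(time_floor T \<longlongrightarrow> x) (at_left x)"
  proof (rule order_tendstoI)
    fix y assume "y < x"
    then obtain r where r: "r \<in> T" "y < r" "r < x" using dense by blast
    have "y < time_floor T u" if "r < u" for u using time_floor_ge[of r T u] r that by simp
    then show "\<forall>\<^sub>F u in at_left x. y < time_floor T u"
      unfolding eventually_at_left[OF \<open>r < x\<close>] using r by auto
  next
    fix y assume "x < y"
    obtain r where r: "r \<in> T" "r < x" using dense[of "x - 1"] by auto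
    have "time_floor T u < y" if "r < u" "u < x" for u
      using time_floor_le[of r T u] r that \<open>x < y\<close> by simp
    then show "\<forall>\<^sub>F u in at_left x. time_floor T u < y"
      unfolding eventually_at_left[OF \<open>r < x\<close>] using r by auto
  qed
  obtain r where r: "r \<in> T" "r < x" using dense[of "x - 1"] by auto
  \<comment> \<open>The limit \<open>l\<close> runs over points of \<open>T\<close> strictly below
    \<open>x\<close>; the floor avoids \<open>x\<close> because it is at most
    \<open>u\<close>.\<close>
  have "time_floor T u \<in> T \<inter> {..<x} \<and> time_floor T u \<noteq> x" if "r < u" "u < x" for u
    using time_floor_le[of r T u] time_floor_in[OF T] r that by force
  then have "\<forall>\<^sub>F u in at_left x. time_floor T u \<in> T \<inter> {..<x} \<and> time_floor T u \<noteq> x"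
    unfolding eventually_at_left[OF \<open>r < x\<close>] using r by blast
  then have "filterlim (time_floor T) (at x within (T \<inter> {..<x})) (at_left x)"
    using lim by (simp add: filterlim_at eventually_conj_iff)
  from filterlim_compose[OF l this] show ?thesis ..
qed

text \<open>If the floor is not constant just to the right of \<open>x\<close>, then
  \<open>x\<close> is right-dense in \<open>T\<close>; the floor is squeezed between
  \<open>x\<close> and \<open>u\<close>, and continuity of \<open>f\<close> at \<open>x\<close>
  applies.\<close>

lemma time_floor_right_limit:
  assumes T: "time_scale T" and f: "rd_continuous T f"
  shows "\<exists>l. ((\<lambda>u. f (time_floor T u)) \<longlongrightarrow> l) (at_right x)"
proof (cases "\<exists>y>x. T \<inter> {x<..<y} = {}")
  case True
  then obtain y where y: "x < y" "T \<inter> {x<..<y} = {}" by blast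
  have "f (time_floor T u) = f (time_floor T x)" if "x < u" "u < y" for u
    using time_floor_eq[of x u T] that y(2) by force
  then show ?thesis
    by (intro exI[of _ "f (time_floor T x)"] tendsto_eventually)
      (use y in \<open>auto simp: eventually_at_right\<close>)
next
  case False
  then have dense: "\<exists>r\<in>T. x < r \<and> r < y" if "x < y" for y using that by force
  have "x \<in> closure T"
    unfolding closure_approachable
  proof (intro allI impI)
    fix e :: real assume "e > 0"
    then obtain r where "r \<in> T" "x < r" "r < x + e" using dense[of "x + e"] by auto
    then show "\<exists>y\<in>T. dist y x < e" by (intro bexI[of _ r]) (auto simp: dist_real_def)
  qed
  then have xT: "x \<in> T" using T by (simp add: time_scale_def)
  have ne: "{s \<in> T. x < s} \<noteq> {}" using dense[of "x + 1"] by auto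
  have "Inf {s \<in> T. x < s} = x"
    using ne dense by (intro cInf_eq_non_empty) (auto simp: not_less[symmetric])
  then have "right_dense T x" using ne by (simp only: right_dense_def fjump_def if_False)
  then have cont: "continuous (at x within T) f"
    using f xT by (auto simp: rd_continuous_def)
  have "((\<lambda>u. f (time_floor T u)) \<longlongrightarrow> f x) (at_right x)"
  proof (rule continuous_within_tendsto_compose[OF cont])
    show "\<forall>\<^sub>F u in at_right x. time_floor T u \<in> T" using time_floor_in[OF T] by simp
    show "(time_floor T \<longlongrightarrow> x) (at_right x)"
    proof (rule tendsto_sandwich[of "\<lambda>_. x" _ _ "\<lambda>u. u"])
      show "\<forall>\<^sub>F u in at_right x. x \<le> time_floor T u"
        using xT by (auto simp: eventually_at_filter intro!: always_eventually time_floor_ge)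
      show "\<forall>\<^sub>F u in at_right x. time_floor T u \<le> u"
        using xT by (auto simp: eventually_at_filter intro!: always_eventually time_floor_le)
    qed (auto intro: tendsto_ident_at)
  qed
  then show ?thesis ..
qed

text \<open>One primitive on the whole line is wanted, as \<open>T\<close> may be unbounded in both
  directions.\<close>

lemma indefinite_integral_exists:
  fixes g :: "real \<Rightarrow> 'a::banach"
  assumes g: "\<And>a b. g integrable_on {a..b}"
  obtains G where "\<And>r s. r \<le> s \<Longrightarrow> (g has_integral (G s - G r)) {r..s}" "continuous_on UNIV G"
proof -
  \<comment> \<open>This is the signed integral from 0: for each \<open>t\<close> at least one of
    the two intervals is empty or a point.\<close>
  define G where "G = (\<lambda>t. integral {0..t} g - integral {t..0} g)"
  have eq: "integral {r..s} g = G s - G r" if "r \<le> s" for r s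
  proof -
    note comb = Henstock_Kurzweil_Integration.integral_combine[OF _ _ g]
    consider "0 \<le> r" | "r < 0" "0 \<le> s" | "s < 0" by linarith
    then show ?thesis
    proof cases
      case 1
      then show ?thesis
        using comb[of 0 r s] that by (cases "r = 0"; cases "s = 0") (auto simp: G_def algebra_simps)
    next
      case 2
      then show ?thesis using comb[of r 0 s] by (cases "s = 0") (auto simp: G_def algebra_simps)
    next
      case 3
      then show ?thesis using comb[of r s 0] that by (auto simp: G_def algebra_simps)
    qed
  qed
  have "(g has_integral (G s - G r)) {r..s}" if "r \<le> s" for r s
    using integrable_integral[OF g[of r s]] eq[OF that] by simp
  moreover have "isCont G t" for t
  proof -
    have "continuous_on {t-1..t+1} (\<lambda>s. G (t - 1) + integral {t-1..s} g)"
      by (intro continuous_intros indefinite_integral_continuous_1 g)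
    then have "continuous_on {t-1..t+1} G"
      by (rule continuous_on_eq) (simp add: eq)
    then show ?thesis by (rule continuous_on_interior) (simp add: interior_atLeastAtMost_real)
  qed
  ultimately show thesis using that[of G] by (auto simp: continuous_at_imp_continuous_on)
qed

text \<open>The primitive of the step extension works: across a gap the integrand is
  \<open>f t\<close>, so the increment is graininess times \<open>f t\<close>; at a right-dense
  point continuity of \<open>f\<close> controls the integrand nearby.\<close>

lemma delta_antiderivative_exists:
  assumes T: "time_scale T" and f: "rd_continuous T f"
  shows "\<exists>F. delta_antiderivative T f F"
proof -
  let ?g = "\<lambda>u. f (time_floor T u)"
  have "?g integrable_on {a..b}" for a b
    using time_floor_left_limit[OF T f] time_floor_right_limit[OF T f]
    by (intro integrable_on_regulated) auto
  then obtain F where F: "\<And>r s. r \<le> s \<Longrightarrow> (?g has_integral (F s - F r)) {r..s}"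
    and cont: "continuous_on UNIV F"
    using indefinite_integral_exists by metis
  have "has_delta_derivative T F (f t) t" if "t \<in> kappa_part T" for t
  proof -
    from that have t: "t \<in> T" by (simp add: kappa_part_def)
    show ?thesis
    proof (cases "fjump T t = t")
      case False
      then have \<sigma>: "t < fjump T t" using fjump_ge[OF t] by simp
      have "?g u = f t" if "t \<le> u" "u < fjump T t" for u
        using time_floor_eq[of t u T] time_floor_self[OF t] that fjump_le[of _ T t] by force
      \<comment> \<open>At the right end of the gap the floor moves on to \<open>fjump T t\<close>;
        this one point leaves the integral unchanged.\<close>
      then have "((\<lambda>u. f t) has_integral (F (fjump T t) - F t)) {t..fjump T t}"
        by (intro has_integral_spike_finite[OF _ _ F[OF less_imp_le[OF \<sigma>]], of "{fjump T t}"]) auto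
      moreover have "((\<lambda>u. f t) has_integral (fjump T t - t) *\<^sub>R f t) {t..fjump T t}"
        using has_integral_const_real[of "f t" t "fjump T t"] \<sigma> by simp
      ultimately have "F (fjump T t) - F t = (fjump T t - t) *\<^sub>R f t"
        by (rule has_integral_unique)
      moreover have "continuous (at t within T) F"
        using cont
        by (auto simp: continuous_on_eq_continuous_at intro: continuous_at_imp_continuous_at_within)
      ultimately show ?thesis
        by (simp add: has_delta_derivative_right_scattered[OF t \<sigma>] graininess_def scaleR_conv_of_real)
    next
      case True
      then have "continuous (at t within T) f" using f t by (auto simp: rd_continuous_def right_dense_def)
      have "\<exists>d>0. \<forall>s\<in>T. \<bar>s - t\<bar> < d \<longrightarrow> norm (F s - F t - (s - t) *\<^sub>R f t) \<le> e * \<bar>s - t\<bar>"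
        if e: "e > 0" for e
      proof -
        obtain d where d: "d > 0" "\<And>s. s \<in> T \<Longrightarrow> \<bar>s - t\<bar> < d \<Longrightarrow> norm (f s - f t) \<le> e"
          using \<open>continuous (at t within T) f\<close> e
          unfolding continuous_within_eps_delta dist_norm real_norm_def by (meson less_imp_le)
        \<comment> \<open>A left endpoint in \<open>T\<close> keeps the floor inside the interval,
          hence close to \<open>t\<close>. The bound is used with \<open>r = t\<close> to the right
          of \<open>t\<close> and with \<open>r' = t\<close> to the left.\<close>
        have bound: "norm (F r' - F r - (r' - r) *\<^sub>R f t) \<le> e * (r' - r)"
          if r: "r \<in> T" "r \<le> r'" and close: "\<And>u. r \<le> u \<Longrightarrow> u \<le> r' \<Longrightarrow> \<bar>u - t\<bar> < d" for r r'
        proof -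
          have "((\<lambda>u. ?g u - f t) has_integral (F r' - F r - (r' - r) *\<^sub>R f t)) {r..r'}"
            using has_integral_diff[OF F[OF r(2)] has_integral_const_real[of "f t" r r']] r by simp
          moreover have "norm (?g u - f t) \<le> e" if "u \<in> {r..r'}" for u
          proof -
            have "r \<le> time_floor T u" "time_floor T u \<le> u"
              using time_floor_ge[of r T u] time_floor_le[of r T u] r that by auto
            then show ?thesis using that by (intro d time_floor_in[OF T] close) auto
          qed
          ultimately show ?thesis
            using has_integral_bound_real[of e "{}"] e r(2)
            by (metis content_real empty_iff finite.emptyI less_imp_le Diff_empty)
        qed
        have "norm (F s - F t - (s - t) *\<^sub>R f t) \<le> e * \<bar>s - t\<bar>" if s: "s \<in> T" "\<bar>s - t\<bar> < d" for s
        proof (cases "t \<le> s")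
          case True
          then show ?thesis using bound[of t s] t s by auto
        next
          case False
          have "norm (F s - F t - (s - t) *\<^sub>R f t) = norm (F t - F s - (t - s) *\<^sub>R f t)"
            by (subst norm_minus_commute[symmetric], rule arg_cong[of _ _ norm]) (simp add: algebra_simps)
          then show ?thesis using bound[of s t] False s by auto
        qed
        with d(1) show ?thesis by blast
      qed
      then show ?thesis
        by (simp add: has_delta_derivative_right_dense[OF True] has_vector_derivative_def
            has_derivative_within_alt bounded_linear_scaleR_left)
    qed
  qed
  then show ?thesis by (auto simp: delta_antiderivative_def)
qed

section \<open>The function zeta and small graininess\<close>

lemma has_field_derivative_Ln_cayley:
  "((\<lambda>w. Ln ((1 + 1/2 * w) / (1 - 1/2 * w))) has_field_derivative 1) (at 0)"
  by (auto intro!: derivative_eq_intros)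

text \<open>Since \<open>h\<close> may vanish along the filter, both branches of
  \<open>cayley_zeta\<close> are merged into \<open>z * k (z * h)\<close>, where \<open>k\<close> is
  continuous at 0 with value 1 because the logarithm of the Cayley quotient has derivative 1
  there.\<close>

lemma cayley_zeta_tendsto:
  assumes h: "(h \<longlongrightarrow> 0) G" and z: "(z \<longlongrightarrow> l) G"
  shows "((\<lambda>s. cayley_zeta (h s) (z s)) \<longlongrightarrow> l) G"
proof -
  define k where "k = (\<lambda>w::complex. if w = 0 then 1 else Ln ((1 + 1/2 * w) / (1 - 1/2 * w)) / w)"
  have "((\<lambda>w::complex. Ln ((1 + 1/2 * w) / (1 - 1/2 * w)) / w) \<longlongrightarrow> 1) (at 0)"
    using has_field_derivative_Ln_cayley by (simp add: has_field_derivative_iff)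
  then have "(k \<longlongrightarrow> 1) (at 0)"
    by (rule Lim_transform_eventually) (simp add: k_def eventually_at_filter)
  then have "isCont k 0" by (simp add: isCont_def k_def)
  moreover have "((\<lambda>s. z s * of_real (h s)) \<longlongrightarrow> 0) G"
    using tendsto_mult[OF z tendsto_of_real[OF h, where 'a=complex]] by simp
  ultimately have "((\<lambda>s. k (z s * of_real (h s))) \<longlongrightarrow> k 0) G"
    by (rule isCont_tendsto_compose)
  then have "((\<lambda>s. z s * k (z s * of_real (h s))) \<longlongrightarrow> l * k 0) G"
    by (intro tendsto_mult z)
  moreover have "cayley_zeta (h s) (z s) = z s * k (z s * of_real (h s))" for s
    by (simp add: cayley_zeta_def k_def mult.assoc)
  ultimately show ?thesis by (simp add: k_def)
qed

text \<open>The factor \<open>h\<close> cancels \<open>1 / h\<close>, and \<open>exp\<close> inverts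
  \<open>Ln\<close> on nonzero arguments; the two excluded values are the zero and the pole of the
  quotient.\<close>

lemma exp_cayley_zeta:
  assumes "h \<noteq> 0" "complex_of_real h * z \<noteq> 2" "complex_of_real h * z \<noteq> -2"
  shows "exp (complex_of_real h * cayley_zeta h z) =
    (2 + complex_of_real h * z) / (2 - complex_of_real h * z)"
proof -
  have nz: "2 + complex_of_real h * z \<noteq> 0" "2 - complex_of_real h * z \<noteq> 0"
    using assms by (auto simp: add_eq_0_iff)
  have half: "(u / 2) / (v / 2) = u / v" for u v :: complex
    by simp
  have "1 + 1/2 * z * complex_of_real h = (2 + complex_of_real h * z) / 2"
    "1 - 1/2 * z * complex_of_real h = (2 - complex_of_real h * z) / 2"
    by (simp_all add: field_simps)
  then have "(1 + 1/2 * z * complex_of_real h) / (1 - 1/2 * z * complex_of_real h) =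
      (2 + complex_of_real h * z) / (2 - complex_of_real h * z)"
    by (simp only: half)
  then show ?thesis using assms(1) nz by (simp add: cayley_zeta_def exp_Ln)
qed

text \<open>A jump from \<open>s < t\<close> cannot pass the point \<open>t\<close> of
  \<open>T\<close>.\<close>

lemma graininess_tendsto_left:
  assumes "t \<in> T"
  shows "(graininess T \<longlongrightarrow> 0) (at t within (T \<inter> {..<t}))"
proof (rule tendsto_sandwich[of "\<lambda>_. 0" _ _ "\<lambda>s. t - s"])
  show "\<forall>\<^sub>F s in at t within (T \<inter> {..<t}). 0 \<le> graininess T s"
    by (auto simp: eventually_at_filter graininess_def intro!: always_eventually fjump_ge)
  show "\<forall>\<^sub>F s in at t within (T \<inter> {..<t}). graininess T s \<le> t - s"
    using assms by (auto simp: eventually_at_filter graininess_def intro!: always_eventually fjump_le)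
  have "((\<lambda>s. t - s) \<longlongrightarrow> t - t) (at t within (T \<inter> {..<t}))" by (intro tendsto_intros)
  then show "((\<lambda>s. t - s) \<longlongrightarrow> 0) (at t within (T \<inter> {..<t}))" by simp
qed simp

lemma graininess_tendsto_right_dense:
  assumes t: "t \<in> T" and rd: "fjump T t = t"
  shows "(graininess T \<longlongrightarrow> 0) (at t within T)"
proof (rule tendstoI)
  fix e :: real
  assume e: "e > 0"
  \<comment> \<open>To the right of \<open>t\<close> the radius is chosen with \<open>t + d\<close>
    in \<open>T\<close>, so that jumps starting before \<open>t + d\<close> stop there at the
    latest; if \<open>t\<close> is the maximum, \<open>d = e\<close> serves.\<close>
  obtain d where d: "0 < d" "d \<le> e"
    and right: "\<And>s. s \<in> T \<Longrightarrow> t < s \<Longrightarrow> s < t + d \<Longrightarrow> t + d \<in> T"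
  proof (cases "\<exists>s\<in>T. t < s")
    case True
    then obtain r where "r \<in> T" "t < r" "r < t + e" using right_denseD[OF rd] e by blast
    then show thesis using that[of "r - t"] by auto
  qed (use that[of e] e in auto)
  have "dist (graininess T s) 0 < e" if s: "s \<in> T" "s \<noteq> t" "dist s t < d" for s
  proof -
    have "fjump T s \<le> (if s < t then t else t + d)"
      using s right t by (auto intro!: fjump_le simp: dist_real_def)
    then show ?thesis
      using fjump_ge[OF s(1)] s d by (auto simp: graininess_def dist_real_def split: if_splits)
  qed
  then show "\<forall>\<^sub>F s in at t within T. dist (graininess T s) 0 < e"
    unfolding eventually_at using d(1) by blast
qed

text \<open>At the points where rd-continuity demands a limit the graininess tends to 0, so the
  limit is that of \<alpha>.\<close>

lemma rd_continuous_cayley_zeta: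
  assumes "rd_continuous T \<alpha>"
  shows "rd_continuous T (\<lambda>s. cayley_zeta (graininess T s) (\<alpha> s))"
  unfolding rd_continuous_def
proof (intro conjI ballI impI)
  fix t assume t: "t \<in> T" "right_dense T t"
  then have "(\<alpha> \<longlongrightarrow> \<alpha> t) (at t within T)"
    using assms by (auto simp: rd_continuous_def continuous_within)
  moreover have "cayley_zeta (graininess T t) (\<alpha> t) = \<alpha> t"
    using t by (simp add: cayley_zeta_def graininess_def right_dense_def)
  ultimately show "continuous (at t within T) (\<lambda>s. cayley_zeta (graininess T s) (\<alpha> s))"
    unfolding continuous_within
    using cayley_zeta_tendsto[OF graininess_tendsto_right_dense, of t T \<alpha>] t
    by (simp add: right_dense_def)
next
  fix t assume t: "t \<in> T" "left_dense T t"
  then obtain l where "(\<alpha> \<longlongrightarrow> l) (at t within (T \<inter> {..<t}))"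
    using assms by (auto simp: rd_continuous_def)
  then show "\<exists>l. ((\<lambda>s. cayley_zeta (graininess T s) (\<alpha> s)) \<longlongrightarrow> l) (at t within (T \<inter> {..<t}))"
    using cayley_zeta_tendsto graininess_tendsto_left t by blast
qed

section \<open>Solutions of the Cauchy problem\<close>

text \<open>At a right-dense point the average is the value itself and the chain rule applies. At a
  right-scattered point the exponential is multiplied by the Cayley quotient, and clearing its
  denominator gives the averaged equation. The constant \<open>c\<close> serves to normalise at
  \<open>t0\<close>.\<close>

lemma exp_antiderivative_solves:
  assumes reg: "regressive T \<alpha>"
    and F: "delta_antiderivative T (\<lambda>s. cayley_zeta (graininess T s) (\<alpha> s)) F"
    and t: "t \<in> kappa_part T"
  shows "has_delta_derivative T (\<lambda>t. exp (F t - c))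
    (\<alpha> t * jump_average T (\<lambda>t. exp (F t - c)) t) t"
proof -
  have tT: "t \<in> T" using t by (simp add: kappa_part_def)
  have dF: "has_delta_derivative T F (cayley_zeta (graininess T t) (\<alpha> t)) t"
    using F t by (simp add: delta_antiderivative_def)
  show ?thesis
  proof (cases "fjump T t = t")
    case True
    then have "(F has_vector_derivative \<alpha> t) (at t within T)"
      using dF by (simp add: has_delta_derivative_right_dense graininess_def cayley_zeta_def)
    then have "((\<lambda>t. F t - c) has_vector_derivative \<alpha> t) (at t within T)"
      by (auto intro!: derivative_eq_intros)
    from field_vector_diff_chain_within[OF this has_field_derivative_at_within[OF DERIV_exp]]
    show ?thesis
      using True by (simp add: has_delta_derivative_right_dense jump_average_def o_def)
  next
    case False
    then have \<sigma>: "t < fjump T t" using fjump_ge[OF tT] by simp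
    define m where "m = complex_of_real (graininess T t)"
    have m: "graininess T t \<noteq> 0" "m * \<alpha> t \<noteq> 2" "m * \<alpha> t \<noteq> -2"
      using \<sigma> reg t by (auto simp: graininess_def regressive_def m_def)
    have F': "continuous (at t within T) F"
      "F (fjump T t) - F t = m * cayley_zeta (graininess T t) (\<alpha> t)"
      using dF has_delta_derivative_right_scattered[OF tT \<sigma>] unfolding m_def by blast+
    have "exp (F (fjump T t) - c) = exp (F t - c) * exp (F (fjump T t) - F t)"
      by (simp flip: exp_add)
    also have "\<dots> = exp (F t - c) * ((2 + m * \<alpha> t) / (2 - m * \<alpha> t))"
      unfolding F' m_def using m by (subst exp_cayley_zeta) (auto simp: m_def)
    finally have "exp (F (fjump T t) - c) * (2 - m * \<alpha> t) = exp (F t - c) * (2 + m * \<alpha> t)"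
      using m by simp
    then have "exp (F (fjump T t) - c) - exp (F t - c) =
        m * (\<alpha> t * ((exp (F t - c) + exp (F (fjump T t) - c)) / 2))"
      by (simp add: field_simps)
    moreover have "continuous (at t within T) (\<lambda>t. exp (F t - c))"
      using F'(1) unfolding continuous_within by (intro tendsto_intros)
    ultimately show ?thesis
      by (simp add: has_delta_derivative_right_scattered[OF tT \<sigma>] jump_average_def m_def)
  qed
qed

text \<open>Both functions have the same logarithmic derivative at right-dense points and the same
  multiplier across a gap, so their quotient is stationary.\<close>

lemma solution_quotient_has_delta_derivative_zero:
  assumes reg: "regressive T \<alpha>" and t: "t \<in> kappa_part T"
    and x: "has_delta_derivative T x (\<alpha> t * jump_average T x t) t"
    and y: "has_delta_derivative T y (\<alpha> t * jump_average T y t) t"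
    and nz: "y t \<noteq> 0" "y (fjump T t) \<noteq> 0"
  shows "has_delta_derivative T (\<lambda>t. x t / y t) 0 t"
proof -
  have tT: "t \<in> T" using t by (simp add: kappa_part_def)
  show ?thesis
  proof (cases "fjump T t = t")
    case True
    have x': "(x has_vector_derivative \<alpha> t * x t) (at t within T)"
      and y': "(y has_vector_derivative \<alpha> t * y t) (at t within T)"
      using x y True by (simp_all add: has_delta_derivative_right_dense jump_average_def)
    have "(inverse has_field_derivative (- (inverse (y t) ^ Suc (Suc 0)))) (at (y t) within y ` T)"
      using nz by (intro DERIV_inverse)
    from has_vector_derivative_mult[OF x' field_vector_diff_chain_within[OF y' this]]
    \<comment> \<open>The two terms of the product rule for \<open>x * inverse y\<close> cancel by
      this identity.\<close>
    moreover have "\<alpha> t * x t * inverse (y t) =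
        x t * (\<alpha> t * y t * (inverse (y t) * inverse (y t)))"
      using nz by (simp add: field_simps)
    ultimately show ?thesis
      using True by (simp add: has_delta_derivative_right_dense o_def divide_inverse)
  next
    case False
    then have \<sigma>: "t < fjump T t" using fjump_ge[OF tT] by simp
    define m where "m = complex_of_real (graininess T t)"
    \<comment> \<open>This is the coefficient of the value at the jump once the average is written
      out, so the implicit equation determines that value.\<close>
    have m: "2 - m * \<alpha> t \<noteq> 0"
      using reg t by (auto simp: regressive_def m_def)
    have step: "z (fjump T t) = z t * ((2 + m * \<alpha> t) / (2 - m * \<alpha> t))"
      if "has_delta_derivative T z (\<alpha> t * jump_average T z t) t" for z
    proof -
      have "z (fjump T t) - z t = m * (\<alpha> t * ((z t + z (fjump T t)) / 2))"
        using that has_delta_derivative_right_scattered[OF tT \<sigma>] by (simp add: m_def jump_average_def)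
      then have "z (fjump T t) * (2 - m * \<alpha> t) = z t * (2 + m * \<alpha> t)"
        by (simp add: field_simps)
      then show ?thesis using m by (simp add: field_simps)
    qed
    have "x (fjump T t) / y (fjump T t) = x t / y t"
      using nz step[OF x] step[OF y] by simp
    moreover have "continuous (at t within T) (\<lambda>t. x t / y t)"
      using has_delta_derivative_continuous[OF tT x] has_delta_derivative_continuous[OF tT y] nz
      unfolding continuous_within by (intro tendsto_intros)
    ultimately show ?thesis
      by (simp add: has_delta_derivative_right_scattered[OF tT \<sigma>])
  qed
qed

theorem theorem3p16:
  fixes T :: "real set" and t0 :: real and \<alpha> :: "real \<Rightarrow> complex"
  assumes "time_scale T"
    and "t0 \<in> T"
    and "regressive T \<alpha>"
    and "rd_continuous T \<alpha>"
  shows "cayley_cauchy_solution T \<alpha> t0 (\<lambda>t. cayley_exp T \<alpha> t t0) \<and>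
         (\<forall>x. cayley_cauchy_solution T \<alpha> t0 x \<longrightarrow> (\<forall>t\<in>T. x t = cayley_exp T \<alpha> t t0))"
proof -
  let ?f = "\<lambda>s. cayley_zeta (graininess T s) (\<alpha> s)"
  \<comment> \<open>This is the very choice made inside \<open>delta_integral\<close>, so the Cayley
    exponential unfolds to \<open>exp (F t - F t0)\<close>; existence makes the choice a genuine
    antiderivative.\<close>
  define F where "F = (SOME F. delta_antiderivative T ?f F)"
  have F: "delta_antiderivative T ?f F"
    unfolding F_def
    using delta_antiderivative_exists[OF assms(1) rd_continuous_cayley_zeta[OF assms(4)]]
    by (rule someI_ex)
  let ?E = "\<lambda>t. exp (F t - F t0)"
  have E: "cayley_exp T \<alpha> t t0 = ?E t" for t
    by (simp add: cayley_exp_def delta_integral_def F_def Let_def)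
  note solves = exp_antiderivative_solves[OF assms(3) F]
  have "x t = ?E t" if x: "cayley_cauchy_solution T \<alpha> t0 x" and t: "t \<in> T" for x t
  proof -
    have "has_delta_derivative T (\<lambda>t. x t / ?E t) 0 t" if "t \<in> kappa_part T" for t
      using x that
      by (intro solution_quotient_has_delta_derivative_zero[OF assms(3) that _ solves])
        (auto simp: cayley_cauchy_solution_def)
    then have "x t / ?E t = x t0 / ?E t0"
      using assms(1,2) t by (intro delta_derivative_zero_constant[of T]) (auto simp: time_scale_def)
    then show ?thesis using x by (simp add: cayley_cauchy_solution_def)
  qed
  then show ?thesis
    unfolding E using solves by (auto simp: cayley_cauchy_solution_def)
qed

end
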